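(* Let $d$ be a positive square-free odd integer, and let $\alpha_d+\beta_d\sqrt{2d}$ (with $\alpha_d,\beta_d\in\mathbb{Z}$) be the fundamental unit of the number field $\mathbb{Q}(\sqrt{2d})$. Let $u,v,t$ be integers with $t>0$ and $(u-1)(v-2)=2dt^2$. Then $(u,v,P,\mathbb{Q})$ is true if and only if there exists a positive integer $m$ such that $$t=\frac{(\alpha_d+\beta_d\sqrt{2d})^m-(\alpha_d-\beta_d\sqrt{2d})^m}{4\sqrt{2d}}.$$
   Context: For integers $u,v$, the phrase "$(u,v,P,\mathbb{Q})$ is true" means: there exist $a,b\in\mathbb{Q}$ with $a\neq 0$ such that the polynomial $P(x,y)=axy+bx+by+\frac{b^2-b}{a}\in\mathbb{Q}[x,y]$, which defines a commutative group operation $x\oplus y=P(x,y)$ on the set $\mathbb{Q}\setminus\{-b/a\}$, satisfies $1\oplus 1=u$ and $2\oplus 2=v$, i.e. $P(1,1)=u$ and $P(2,2)=v$. (The conditions are on the values of the polynomial; it is not required that $1$ and $2$ differ from $-b/a$.) Convention on fundamental units: for $D=2d$, the ring of integers of $\mathbb{Q}(\sqrt{D})$ is $\mathbb{Z}[\sqrt{D}]$, with norm $N(n+s\sqrt{D})=n^2-Ds^2$; the fundamental unit means the smallest element $\epsilon>1$ of $\mathbb{Z}[\sqrt{D}]$ with $N(\epsilon)=1$. *)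

theory Defs
  imports Complex_Main "HOL-Computational_Algebra.Squarefree" "HOL-Algebra.Group"
begin

definition grp_poly :: "rat \<Rightarrow> rat \<Rightarrow> rat \<Rightarrow> rat \<Rightarrow> rat" where
  "grp_poly a b x y = a * x * y + b * x + b * y + (b\<^sup>2 - b) / a"

text \<open>Substituting \<open>X = a x + b\<close> turns \<open>grp_poly\<close> into multiplication of nonzero rationals, so the
  group property imposes no condition on \<open>a\<close> and \<open>b\<close> beyond \<open>a \<noteq> 0\<close>.\<close>

lemma grp_poly_affine:
  assumes "a \<noteq> 0"
  shows "a * grp_poly a b x y + b = (a * x + b) * (a * y + b)"
  using assms by (simp add: grp_poly_def field_simps power2_eq_square)

lemma comm_group_grp_poly:
  assumes a: "a \<noteq> 0"
  shows "comm_group \<lparr>carrier = UNIV - {- b / a}, monoid.mult = grp_poly a b, one = (1 - b) / a\<rparr>"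
proof -
  have ne: "x \<noteq> - b / a \<longleftrightarrow> a * x + b \<noteq> 0" for x
    using a by (simp add: field_simps add_eq_0_iff)
  have inj: "x = y \<longleftrightarrow> a * x + b = a * y + b" for x y
    using a by simp
  have one: "a * ((1 - b) / a) + b = 1"
    using a by simp
  let ?G = "\<lparr>carrier = UNIV - {- b / a}, monoid.mult = grp_poly a b, one = (1 - b) / a\<rparr>"
  have car: "x \<in> carrier ?G \<longleftrightarrow> a * x + b \<noteq> 0" for x
    using ne[of x] by simp
  show ?thesis
  proof (rule comm_groupI)
    show "x \<otimes>\<^bsub>?G\<^esub> y \<in> carrier ?G" if "x \<in> carrier ?G" "y \<in> carrier ?G" for x y
      using that unfolding car by (simp add: grp_poly_affine[OF a])
    show "\<one>\<^bsub>?G\<^esub> \<in> carrier ?G"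
      unfolding car using a by simp
    show "x \<otimes>\<^bsub>?G\<^esub> y \<otimes>\<^bsub>?G\<^esub> z = x \<otimes>\<^bsub>?G\<^esub> (y \<otimes>\<^bsub>?G\<^esub> z)" for x y z
      unfolding inj[of "x \<otimes>\<^bsub>?G\<^esub> y \<otimes>\<^bsub>?G\<^esub> z"]
      by (simp add: grp_poly_affine[OF a] mult.assoc del: mult_cancel_left add_right_cancel)
    show "x \<otimes>\<^bsub>?G\<^esub> y = y \<otimes>\<^bsub>?G\<^esub> x" for x y
      by (simp add: grp_poly_def)
    show "\<one>\<^bsub>?G\<^esub> \<otimes>\<^bsub>?G\<^esub> x = x" for x
      using a by (simp add: grp_poly_def field_simps power2_eq_square)
    show "\<exists>y\<in>carrier ?G. y \<otimes>\<^bsub>?G\<^esub> x = \<one>\<^bsub>?G\<^esub>" if "x \<in> carrier ?G" for x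
    proof
      have x: "a * x + b \<noteq> 0"
        using that unfolding car .
      let ?y = "(1 / (a * x + b) - b) / a"
      have y: "a * ?y + b = 1 / (a * x + b)"
        using a by simp
      show "?y \<in> carrier ?G"
        unfolding car y using x by simp
      have "grp_poly a b ?y x = (1 - b) / a"
        unfolding inj[of "grp_poly a b ?y x"] grp_poly_affine[OF a] y one using x by simp
      then show "?y \<otimes>\<^bsub>?G\<^esub> x = \<one>\<^bsub>?G\<^esub>"
        by simp
    qed
  qed
qed

text \<open>The condition is on the values of the polynomial; 1 and 2 may lie outside the carrier.\<close>

definition uvPQ_true :: "int \<Rightarrow> int \<Rightarrow> bool" where
  "uvPQ_true u v \<longleftrightarrow> (\<exists>a b. a \<noteq> 0 \<and> grp_poly a b 1 1 = of_int u \<and> grp_poly a b 2 2 = of_int v)"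

text \<open>The element \<open>n + s \<surd>D\<close> of \<open>\<int>[\<surd>D]\<close>, as a real number, and its norm.\<close>

definition quad_elt :: "int \<Rightarrow> int \<Rightarrow> int \<Rightarrow> real" where
  "quad_elt D n s = of_int n + of_int s * sqrt (of_int D)"

definition quad_norm :: "int \<Rightarrow> int \<Rightarrow> int \<Rightarrow> int" where
  "quad_norm D n s = n\<^sup>2 - D * s\<^sup>2"

text \<open>Only norm \<open>1\<close> is admitted: where a unit of norm \<open>-1\<close> exists, this is the square of the
  usual fundamental unit (e.g. \<open>3 + 2 \<surd>2\<close> rather than \<open>1 + \<surd>2\<close> for \<open>D = 2\<close>). The ring of integers
  of the quadratic field is \<open>\<int>[\<surd>D]\<close> for squarefree \<open>D \<equiv> 2, 3 (mod 4)\<close>.\<close>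

definition fundamental_unit :: "int \<Rightarrow> int \<Rightarrow> int \<Rightarrow> bool" where
  "fundamental_unit D \<alpha> \<beta> \<longleftrightarrow>
     quad_norm D \<alpha> \<beta> = 1 \<and> quad_elt D \<alpha> \<beta> > 1 \<and>
     (\<forall>n s. quad_norm D n s = 1 \<and> quad_elt D n s > 1 \<longrightarrow> quad_elt D \<alpha> \<beta> \<le> quad_elt D n s)"

end

theory Submission
  imports Defs
begin

text \<open>
  The values of the group law at 1 and 2 give two equations for \<open>a\<close> and \<open>b\<close>. With
  \<open>p = a + b\<close> (the image of 1 under \<open>x \<mapsto> a x + b\<close>, which turns the group law into
  multiplication) and \<open>U = u - 1\<close>, \<open>V = v - 2\<close>, they become \<open>p\<^sup>2 - p = U a\<close> and
  \<open>(p + a)\<^sup>2 - (p + a) = V a\<close>. Subtracting and cancelling \<open>a\<close> gives \<open>a = V - U + 1 - 2 p\<close>, and what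
  remains is one quadratic equation for \<open>p\<close> whose discriminant is \<open>1 + 4 U V\<close>. Hence rational
  solutions exist exactly if \<open>1 + 4 U V\<close> is a square (\<open>uvPQ_true_iff_square\<close>).

  If \<open>U V = 2 d t\<^sup>2\<close>, this says that \<open>s\<^sup>2 - 2 d (2 t)\<^sup>2 = 1\<close> for some integer \<open>s\<close>, a Pell equation. So
  \<open>s + 2 t \<surd>(2 d)\<close> is a unit of norm 1, which by the usual descent is a power of the fundamental unit
  (\<open>norm_one_eq_power\<close>). Its \<open>\<surd>(2 d)\<close>-coordinate \<open>2 t\<close> is read off by subtracting the conjugate.
\<close>

section \<open>The group law and squares\<close>

lemma int_square_of_rat_square:
  fixes r :: rat and n :: int
  assumes "r\<^sup>2 = of_int n"
  obtains s where "r = of_int s" "s\<^sup>2 = n"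
proof -
  obtain p q where pq: "r = of_int p / of_int q" "q > 0"
    using quotient_of_div[of r] quotient_of_denom_pos[of r]
    by (metis prod.collapse)
  have "(of_int (p\<^sup>2) :: rat) = of_int (n * q\<^sup>2)"
    using assms pq by (simp add: field_simps)
  then have "p\<^sup>2 = n * q\<^sup>2"
    by (simp only: of_int_eq_iff)
  then have "q\<^sup>2 dvd p\<^sup>2"
    by simp
  then have "q dvd p"
    by simp
  then obtain s where "p = q * s" ..
  with pq have r: "r = of_int s"
    by simp
  with assms have "(of_int (s\<^sup>2) :: rat) = of_int n"
    by simp
  then have "s\<^sup>2 = n"
    by (simp only: of_int_eq_iff)
  with r show thesis ..
qed

text \<open>The discriminant criterion. The two roots \<open>p\<close> belong to \<open>a = U + V + s\<close> and \<open>a = U + V - s\<close>, and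
  since \<open>s\<^sup>2 = 1 + 4 U V\<close> is odd, \<open>s \<noteq> 0\<close>, so that at least one of the two \<open>a\<close> is nonzero.\<close>

lemma uvPQ_true_iff_square:
  "uvPQ_true u v \<longleftrightarrow> (\<exists>s::int. s\<^sup>2 = 1 + 4 * ((u - 1) * (v - 2)))"
proof
  assume "uvPQ_true u v"
  then obtain a b :: rat where a: "a \<noteq> 0"
    and one: "grp_poly a b 1 1 = of_int u" and two: "grp_poly a b 2 2 = of_int v"
    unfolding uvPQ_true_def by blast
  define U V where "U = (of_int u - 1 :: rat)" and "V = (of_int v - 2 :: rat)"
  define p where "p = a + b"
  have eq1: "p\<^sup>2 - p = U * a"
    using grp_poly_affine[OF a, of b 1 1] unfolding one p_def U_def
    by (simp add: algebra_simps power2_eq_square)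
  have eq2: "(p + a)\<^sup>2 - (p + a) = V * a"
    using grp_poly_affine[OF a, of b 2 2] unfolding two p_def V_def
    by (simp add: algebra_simps power2_eq_square)
  have "a * (U + 2 * p + a - 1) = a * V"
    using eq1 eq2 by (simp add: algebra_simps power2_eq_square)
  then have a_eq: "a = V - U + 1 - 2 * p"
    using a by simp
  \<comment> \<open>completing the square in the quadratic equation for \<open>p\<close>\<close>
  have "(U + V - a)\<^sup>2 = 1 + 4 * (U * V)"
    using eq1 unfolding a_eq by (simp add: algebra_simps power2_eq_square)
  then have "(U + V - a)\<^sup>2 = of_int (1 + 4 * ((u - 1) * (v - 2)))"
    unfolding U_def V_def by simp
  then show "\<exists>s. s\<^sup>2 = 1 + 4 * ((u - 1) * (v - 2))"
    by (rule int_square_of_rat_square) blast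
next
  assume "\<exists>s. s\<^sup>2 = 1 + 4 * ((u - 1) * (v - 2))"
  then obtain s where s: "s\<^sup>2 = 1 + 4 * ((u - 1) * (v - 2))" ..
  have "s \<noteq> 0"
  proof
    assume "s = 0"
    with s have "1 + 4 * ((u - 1) * (v - 2)) = 0" by simp
    then show False by presburger
  qed
  then obtain s' where s': "s'\<^sup>2 = 1 + 4 * ((u - 1) * (v - 2))" "u - 1 + (v - 2) + s' \<noteq> 0"
    using s that[of s] that[of "- s"] by (cases "u - 1 + (v - 2) + s = 0") auto
  define U V r where "U = (of_int u - 1 :: rat)" and "V = (of_int v - 2 :: rat)"
    and "r = (of_int s' :: rat)"
  define a b where "a = U + V + r" and "b = (1 - 2 * U - r) / 2 - a"
  have "of_int (s'\<^sup>2) = (of_int (1 + 4 * ((u - 1) * (v - 2))) :: rat)"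
    using s'(1) by (simp only:)
  then have r: "r\<^sup>2 = 1 + 4 * (U * V)"
    unfolding U_def V_def r_def by simp
  have "a = of_int (u - 1 + (v - 2) + s')"
    unfolding a_def U_def V_def r_def by simp
  then have a: "a \<noteq> 0"
    using s'(2) by (simp only: of_int_eq_0_iff) simp
  have "(a + b)\<^sup>2 - (a + b) = U * a" "(2 * a + b)\<^sup>2 - (2 * a + b) = V * a"
    using r unfolding b_def a_def by (simp_all add: field_simps power2_eq_square)
  then have "a * grp_poly a b 1 1 = a * of_int u" "a * grp_poly a b 2 2 = a * of_int v"
    using grp_poly_affine[OF a, of b 1 1] grp_poly_affine[OF a, of b 2 2]
    unfolding U_def V_def by (simp_all add: algebra_simps power2_eq_square)
  with a show "uvPQ_true u v"
    unfolding uvPQ_true_def by auto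
qed

section \<open>Units of norm 1\<close>

lemma quad_elt_mult:
  assumes "D \<ge> 0"
  shows "quad_elt D n s * quad_elt D n' s' = quad_elt D (n * n' + D * (s * s')) (n * s' + s * n')"
proof -
  have "sqrt (of_int D) * sqrt (of_int D) = of_int D"
    using assms by simp
  then show ?thesis
    unfolding quad_elt_def by (simp add: algebra_simps)
qed

lemma quad_norm_mult:
  "quad_norm D (n * n' + D * (s * s')) (n * s' + s * n') = quad_norm D n s * quad_norm D n' s'"
  unfolding quad_norm_def by algebra

lemma quad_elt_mult_conj:
  assumes "D \<ge> 0"
  shows "quad_elt D n s * quad_elt D n (- s) = of_int (quad_norm D n s)"
  unfolding quad_elt_mult[OF assms]
  by (simp add: quad_elt_def quad_norm_def power2_eq_square algebra_simps)

text \<open>Powers of an element and of its conjugate are tracked together, so that the two coordinates of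
  a power can be recovered from real numbers.\<close>

lemma quad_elt_power:
  assumes "D \<ge> 0" "quad_norm D \<alpha> \<beta> = 1"
  obtains x y where "quad_elt D \<alpha> \<beta> ^ m = quad_elt D x y"
    "quad_elt D \<alpha> (- \<beta>) ^ m = quad_elt D x (- y)" "quad_norm D x y = 1"
proof (induction m arbitrary: thesis)
  case 0
  show ?case
    by (rule 0[of 1 0]) (simp_all add: quad_elt_def quad_norm_def)
next
  case (Suc m)
  obtain x y where xy: "quad_elt D \<alpha> \<beta> ^ m = quad_elt D x y"
    "quad_elt D \<alpha> (- \<beta>) ^ m = quad_elt D x (- y)" "quad_norm D x y = 1"
    by (rule Suc.IH)
  show ?case
  proof (rule Suc.prems)
    show "quad_elt D \<alpha> \<beta> ^ Suc m = quad_elt D (\<alpha> * x + D * (\<beta> * y)) (\<alpha> * y + \<beta> * x)"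
      using xy by (simp add: quad_elt_mult[OF assms(1)])
    show "quad_elt D \<alpha> (- \<beta>) ^ Suc m = quad_elt D (\<alpha> * x + D * (\<beta> * y)) (- (\<alpha> * y + \<beta> * x))"
      using xy by (simp add: quad_elt_mult[OF assms(1)])
    show "quad_norm D (\<alpha> * x + D * (\<beta> * y)) (\<alpha> * y + \<beta> * x) = 1"
      using xy assms(2) by (simp only: quad_norm_mult)
  qed
qed

text \<open>Descent: dividing by the largest power of the fundamental unit \<open>\<epsilon>\<close> that does not exceed the
  given unit leaves a unit of norm 1 in \<open>[1, \<epsilon>)\<close>, which is 1 by the minimality of \<open>\<epsilon>\<close>.\<close>

lemma norm_one_eq_power:
  assumes D: "D \<ge> 0" and fu: "fundamental_unit D \<alpha> \<beta>"
    and norm: "quad_norm D n s = 1" and ge1: "quad_elt D n s \<ge> 1"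
  obtains m where "quad_elt D n s = quad_elt D \<alpha> \<beta> ^ m"
proof -
  define \<epsilon> \<epsilon>' z where "\<epsilon> = quad_elt D \<alpha> \<beta>" and "\<epsilon>' = quad_elt D \<alpha> (- \<beta>)" and "z = quad_elt D n s"
  have \<epsilon>: "\<epsilon> > 1" and N: "quad_norm D \<alpha> \<beta> = 1"
    and least: "\<And>n s. quad_norm D n s = 1 \<Longrightarrow> quad_elt D n s > 1 \<Longrightarrow> \<epsilon> \<le> quad_elt D n s"
    using fu unfolding fundamental_unit_def \<epsilon>_def by auto
  have "\<epsilon> * \<epsilon>' = 1"
    unfolding \<epsilon>_def \<epsilon>'_def by (simp add: quad_elt_mult_conj[OF D] N)
  then have inv: "\<epsilon> ^ m * \<epsilon>' ^ m = 1" for m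
    by (simp flip: power_mult_distrib)
  have ex: "\<exists>k. z < \<epsilon> ^ k"
    using real_arch_pow[OF \<epsilon>] by blast
  define k where "k = (LEAST k. z < \<epsilon> ^ k)"
  have k: "z < \<epsilon> ^ k"
    unfolding k_def using ex by (rule LeastI_ex)
  have "k \<noteq> 0"
    using k ge1 unfolding z_def by (cases k) auto
  then obtain m where km: "k = Suc m"
    using not0_implies_Suc by blast
  have le: "\<epsilon> ^ m \<le> z"
    using not_less_Least[of m "\<lambda>k. z < \<epsilon> ^ k"] km unfolding k_def by simp
  have pos: "\<epsilon>' ^ m > 0"
    using inv[of m] \<epsilon> by (smt (verit) zero_less_mult_pos zero_less_power)
  obtain x y where xy: "\<epsilon> ^ m = quad_elt D x y" "\<epsilon>' ^ m = quad_elt D x (- y)" "quad_norm D x y = 1"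
    using quad_elt_power[OF D N] unfolding \<epsilon>_def \<epsilon>'_def by blast
  have w: "z * \<epsilon>' ^ m = quad_elt D (n * x + D * (s * - y)) (n * - y + s * x)"
    unfolding z_def xy(2) by (rule quad_elt_mult[OF D])
  have wN: "quad_norm D (n * x + D * (s * - y)) (n * - y + s * x) = 1"
    unfolding quad_norm_mult using norm xy(3) by (simp add: quad_norm_def)
  have "z * \<epsilon>' ^ m < \<epsilon>"
  proof -
    have "z * \<epsilon>' ^ m < \<epsilon> ^ k * \<epsilon>' ^ m"
      using k pos by simp
    also have "\<dots> = \<epsilon>"
      using inv[of m] unfolding km by (simp add: mult.assoc)
    finally show ?thesis .
  qed
  then have "\<not> z * \<epsilon>' ^ m > 1"
    using least[OF wN] unfolding w by linarith
  moreover have "z * \<epsilon>' ^ m \<ge> 1"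
    using mult_right_mono[OF le, of "\<epsilon>' ^ m"] inv[of m] pos by simp
  ultimately have "z * \<epsilon>' ^ m = \<epsilon> ^ m * \<epsilon>' ^ m"
    using inv[of m] by simp
  then have "z = \<epsilon> ^ m"
    using pos mult_right_cancel[of "\<epsilon>' ^ m" z "\<epsilon> ^ m"] by linarith
  then show thesis
    using that unfolding z_def \<epsilon>_def by blast
qed

section \<open>The criterion\<close>

theorem theorem3:
  fixes d \<alpha> \<beta> u v t :: int
  assumes "d > 0" and "squarefree d" and "odd d"
    and "fundamental_unit (2 * d) \<alpha> \<beta>"
    and "t > 0"
    and "(u - 1) * (v - 2) = 2 * d * t\<^sup>2"
  shows "uvPQ_true u v \<longleftrightarrow>
    (\<exists>m::nat. m > 0 \<and>
      real_of_int t =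
        ((of_int \<alpha> + of_int \<beta> * sqrt (of_int (2 * d))) ^ m
          - (of_int \<alpha> - of_int \<beta> * sqrt (of_int (2 * d))) ^ m)
        / (4 * sqrt (of_int (2 * d))))"
proof -
  define D where "D = 2 * d"
  have D: "D > 0" "D \<ge> 0" and fu: "fundamental_unit D \<alpha> \<beta>"
    using assms unfolding D_def by auto
  define R where "R = sqrt (of_int D)"
  have R: "R > 0"
    unfolding R_def using D by simp
  have N: "quad_norm D \<alpha> \<beta> = 1"
    using fu unfolding fundamental_unit_def by blast
  have pell: "uvPQ_true u v \<longleftrightarrow> (\<exists>s. quad_norm D s (2 * t) = 1)"
    unfolding uvPQ_true_iff_square quad_norm_def assms(6) D_def by (simp add: algebra_simps)
  \<comment> \<open>the right-hand side is half of the second coordinate of the power\<close>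
  have coord: "(quad_elt D \<alpha> \<beta> ^ m - quad_elt D \<alpha> (- \<beta>) ^ m) / (4 * R) = of_int y / 2"
    if "quad_elt D \<alpha> \<beta> ^ m = quad_elt D x y" "quad_elt D \<alpha> (- \<beta>) ^ m = quad_elt D x (- y)" for m x y
    unfolding that using R by (simp add: quad_elt_def flip: R_def)
  have "uvPQ_true u v \<longleftrightarrow>
    (\<exists>m>0. real_of_int t = (quad_elt D \<alpha> \<beta> ^ m - quad_elt D \<alpha> (- \<beta>) ^ m) / (4 * R))"
    unfolding pell
  proof
    assume "\<exists>s. quad_norm D s (2 * t) = 1"
    then obtain s0 where "quad_norm D s0 (2 * t) = 1" ..
    then have s: "quad_norm D \<bar>s0\<bar> (2 * t) = 1"
      by (simp add: quad_norm_def)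
    then have "\<bar>s0\<bar> \<noteq> 0"
      using D unfolding quad_norm_def by (smt (verit) mult_nonneg_nonneg zero_le_power2 zero_power2)
    then have "of_int \<bar>s0\<bar> \<ge> (1::real)"
      by linarith
    moreover have "of_int (2 * t) * R > 0"
      using R assms(5) by simp
    ultimately have gt1: "quad_elt D \<bar>s0\<bar> (2 * t) > 1"
      unfolding quad_elt_def R_def by linarith
    then obtain m where m: "quad_elt D \<bar>s0\<bar> (2 * t) = quad_elt D \<alpha> \<beta> ^ m"
      using norm_one_eq_power[OF D(2) fu s] by auto
    \<comment> \<open>conjugates are inverses here, so the conjugates of the two sides agree as well\<close>
    have "quad_elt D \<alpha> \<beta> ^ m * quad_elt D \<alpha> (- \<beta>) ^ m = 1"
      by (simp add: quad_elt_mult_conj[OF D(2)] N flip: power_mult_distrib)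
    moreover have "quad_elt D \<bar>s0\<bar> (2 * t) * quad_elt D \<bar>s0\<bar> (- (2 * t)) = 1"
      unfolding quad_elt_mult_conj[OF D(2)] s by simp
    ultimately have conj: "quad_elt D \<alpha> (- \<beta>) ^ m = quad_elt D \<bar>s0\<bar> (- (2 * t))"
      using m gt1 by (metis mult_left_cancel mult_zero_left zero_neq_one)
    have "m > 0"
      using m gt1 by (cases m) auto
    then show "\<exists>m>0. real_of_int t = (quad_elt D \<alpha> \<beta> ^ m - quad_elt D \<alpha> (- \<beta>) ^ m) / (4 * R)"
      using coord[OF m[symmetric] conj] by auto
  next
    assume "\<exists>m>0. real_of_int t = (quad_elt D \<alpha> \<beta> ^ m - quad_elt D \<alpha> (- \<beta>) ^ m) / (4 * R)"
    then obtain m where m: "real_of_int t = (quad_elt D \<alpha> \<beta> ^ m - quad_elt D \<alpha> (- \<beta>) ^ m) / (4 * R)"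
      by blast
    obtain x y where xy: "quad_elt D \<alpha> \<beta> ^ m = quad_elt D x y"
      "quad_elt D \<alpha> (- \<beta>) ^ m = quad_elt D x (- y)" "quad_norm D x y = 1"
      by (rule quad_elt_power[OF D(2) N])
    have "real_of_int t = of_int y / 2"
      unfolding m by (rule coord[OF xy(1,2)])
    then have "y = 2 * t"
      by linarith
    with xy(3) show "\<exists>s. quad_norm D s (2 * t) = 1"
      by blast
  qed
  then show ?thesis
    unfolding quad_elt_def R_def D_def by simp
qed

end
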